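(* For any integer $t\ge 3$ and all reals $0\le\alpha'\le\alpha<t-1$ with $\alpha'>\frac{t(\alpha-1)+1}{t-1}$, the problem $\mathrm{sparse}\text{-}t\text{-}\mathrm{uni}\text{-}\mathrm{HDS}_{\alpha',\alpha}$ can be solved in linear time.
   Context: For $t\ge 3$ and $0\le\alpha'\le\alpha<t-1$, the problem $\mathrm{sparse}\text{-}t\text{-}\mathrm{uni}\text{-}\mathrm{HDS}_{\alpha',\alpha}$ is the decision problem whose inputs are integer degree sequences $D=(d_1,\dots,d_n)$ of length $n$ with $n^{\alpha'}\le d_i\le 6n^{\alpha}$ for all $i$, and which asks whether there exists a simple $t$-uniform hypergraph (distinct hyperedges, each of exactly $t$ vertices) on vertices $v_1,\dots,v_n$ in which $v_i$ is contained in exactly $d_i$ hyperedges for every $i$. *)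

theory Defs
  imports Complex_Main "HOL-Library.Landau_Symbols"
begin

section \<open>Uniform hypergraphs and degree sequences\<close>

text \<open>A simple hypergraph on \<open>V\<close> is a set of vertex sets, so repeated hyperedges are impossible.\<close>

definition uniform_hypergraph :: "nat \<Rightarrow> 'v set \<Rightarrow> 'v set set \<Rightarrow> bool" where
  "uniform_hypergraph t V E \<longleftrightarrow> (\<forall>e\<in>E. e \<subseteq> V \<and> card e = t)"

definition hdegree :: "'v set set \<Rightarrow> 'v \<Rightarrow> nat" where
  "hdegree E v = card {e \<in> E. v \<in> e}"

definition uni_hypergraphic :: "nat \<Rightarrow> nat list \<Rightarrow> bool" where
  "uni_hypergraphic t D \<longleftrightarrow>
     (\<exists>E. uniform_hypergraph t {..<length D} E \<and> (\<forall>i<length D. hdegree E i = D ! i))"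

text \<open>Admissible inputs. Nothing is lost by using natural numbers: for a nonempty sequence
  the lower bound forces every entry to be positive.\<close>

definition sparse_HDS_inputs :: "real \<Rightarrow> real \<Rightarrow> nat list set" where
  "sparse_HDS_inputs \<alpha>' \<alpha> =
     {D. \<forall>d\<in>set D. real (length D) powr \<alpha>' \<le> real d \<and> real d \<le> 6 * real (length D) powr \<alpha>}"


section \<open>Deterministic multitape Turing machines\<close>

text \<open>\<open>Zero\<close>, \<open>One\<close> and \<open>Sep\<close> are the input symbols; the \<open>Aux\<close> symbols supply arbitrarily large
  finite working alphabets.\<close>

datatype sym = Blank | Zero | One | Sep | Aux nat

datatype dir = GoLeft | Stay | GoRight

record tm =
  num_tapes :: nat
  states :: "nat set"
  symbols :: "sym set"
  start :: nat
  accept :: nat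
  reject :: nat
  delta :: "nat \<Rightarrow> sym list \<Rightarrow> nat \<times> (sym \<times> dir) list"

text \<open>Only the restriction of \<open>delta\<close> to \<open>states\<close> and to tuples over \<open>symbols\<close> matters, so a
  well-formed machine is a finite object.\<close>

definition wf_tm :: "tm \<Rightarrow> bool" where
  "wf_tm M \<longleftrightarrow>
     num_tapes M \<ge> 1 \<and> finite (states M) \<and> finite (symbols M) \<and>
     {Blank, Zero, One, Sep} \<subseteq> symbols M \<and>
     {start M, accept M, reject M} \<subseteq> states M \<and> accept M \<noteq> reject M \<and>
     (\<forall>q\<in>states M. \<forall>xs. length xs = num_tapes M \<and> set xs \<subseteq> symbols M \<longrightarrow>
        fst (delta M q xs) \<in> states M \<and>
        length (snd (delta M q xs)) = num_tapes M \<and>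
        fst ` set (snd (delta M q xs)) \<subseteq> symbols M)"

text \<open>A tape is infinite in both directions and is paired with its head position.\<close>

type_synonym tape = "(int \<Rightarrow> sym) \<times> int"
type_synonym config = "nat \<times> tape list"

definition read_tape :: "tape \<Rightarrow> sym" where
  "read_tape tp = fst tp (snd tp)"

fun move :: "dir \<Rightarrow> int \<Rightarrow> int" where
  "move GoLeft p = p - 1"
| "move Stay p = p"
| "move GoRight p = p + 1"

fun act_tape :: "sym \<times> dir \<Rightarrow> tape \<Rightarrow> tape" where
  "act_tape (s, d) (f, p) = (f(p := s), move d p)"

fun step :: "tm \<Rightarrow> config \<Rightarrow> config" where
  "step M (q, tps) =
     (if q = accept M \<or> q = reject M then (q, tps)
      else (let (q', as) = delta M q (map read_tape tps) in (q', map2 act_tape as tps)))"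

definition blank_tape :: tape where
  "blank_tape = ((\<lambda>_. Blank), 0)"

definition input_tape :: "sym list \<Rightarrow> tape" where
  "input_tape w = ((\<lambda>i. if 0 \<le> i \<and> i < int (length w) then w ! nat i else Blank), 0)"

definition init_config :: "tm \<Rightarrow> sym list \<Rightarrow> config" where
  "init_config M w = (start M, input_tape w # replicate (num_tapes M - 1) blank_tape)"

definition state_after :: "tm \<Rightarrow> nat \<Rightarrow> sym list \<Rightarrow> nat" where
  "state_after M k w = fst ((step M ^^ k) (init_config M w))"

text \<open>Since halting configurations are fixed points of \<open>step\<close>, being in state \<open>accept M\<close> or
  \<open>reject M\<close> after \<open>k\<close> steps means having halted with that verdict within \<open>k\<close> steps. Nothing is
  required on words that do not encode an element of \<open>I\<close>.\<close>

definition solvable_in_linear_time :: "('a \<Rightarrow> sym list) \<Rightarrow> 'a set \<Rightarrow> ('a \<Rightarrow> bool) \<Rightarrow> bool" where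
  "solvable_in_linear_time enc I P \<longleftrightarrow>
     (\<exists>M (T :: nat \<Rightarrow> nat). wf_tm M \<and> (\<lambda>n. real (T n)) \<in> O(\<lambda>n. real n) \<and>
        (\<forall>x\<in>I. state_after M (T (length (enc x))) (enc x) = (if P x then accept M else reject M)))"


section \<open>Encoding of sequences\<close>

text \<open>Binary notation, most significant digit first and without leading zeros, each entry being
  followed by a separator.\<close>

fun bin :: "nat \<Rightarrow> sym list" where
  "bin n = (if n = 0 then [] else bin (n div 2) @ [if even n then Zero else One])"

declare bin.simps [simp del]

definition enc_seq :: "nat list \<Rightarrow> sym list" where
  "enc_seq D = concat (map (\<lambda>d. bin d @ [Sep]) D)"

lemma bin_inject: "bin m = bin n \<longleftrightarrow> m = n"
proof
  show "bin m = bin n \<Longrightarrow> m = n"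
  proof (induction m arbitrary: n rule: less_induct)
    case (less m)
    show ?case
    proof (cases "m = 0 \<or> n = 0")
      case True
      then show ?thesis using less.prems bin.simps[of m] bin.simps[of n]
        by (auto split: if_splits)
    next
      case False
      then have "bin (m div 2) = bin (n div 2)" and p: "even m = even n"
        using less.prems bin.simps[of m] bin.simps[of n] by (auto split: if_splits)
      then have "m div 2 = n div 2" using less.IH[of "m div 2"] False by simp
      with p show ?thesis by (metis div_mult_mod_eq even_iff_mod_2_eq_zero odd_iff_mod_2_eq_one)
    qed
  qed
qed simp

lemma Sep_notin_bin: "Sep \<notin> set (bin n)"
proof (induction n rule: less_induct)
  case (less n)
  then show ?case by (subst bin.simps) auto
qed

lemma append_sep_cancel:
  "xs @ x # ys = xs' @ x # ys' \<Longrightarrow> x \<notin> set xs \<Longrightarrow> x \<notin> set xs' \<Longrightarrow> xs = xs' \<and> ys = ys'"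
proof (induction xs arbitrary: xs')
  case Nil
  then show ?case by (cases xs') auto
next
  case (Cons a xs)
  then show ?case by (cases xs') auto
qed

lemma inj_enc_seq: "inj enc_seq"
proof (rule injI)
  show "enc_seq D = enc_seq D' \<Longrightarrow> D = D'" for D D'
  proof (induction D arbitrary: D')
    case Nil
    then show ?case by (cases D') (auto simp: enc_seq_def)
  next
    case (Cons d D)
    then obtain d' D'' where D': "D' = d' # D''" by (cases D') (auto simp: enc_seq_def)
    have eq: "bin d @ Sep # enc_seq D = bin d' @ Sep # enc_seq D''"
      using Cons.prems by (simp add: D' enc_seq_def)
    then have "bin d = bin d' \<and> enc_seq D = enc_seq D''"
      using Sep_notin_bin[of d] Sep_notin_bin[of d']
      by (rule append_sep_cancel)
    then show ?case using Cons.IH D' bin_inject by auto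
  qed
qed

end

theory Submission
  imports Defs
begin

text \<open>
  Let \<open>\<sigma>\<close> be the degree sum, \<open>\<Delta>\<close> the maximal degree and \<open>k = \<sigma> div \<Delta>\<close>. Whenever \<open>v\<close> has larger
  degree than \<open>w\<close>, some hyperedge can be moved from \<open>v\<close> to \<open>w\<close>. Such moves turn any \<open>t\<close>-uniform
  hypergraph with \<open>\<sigma> / t\<close> hyperedges on the \<open>k\<close> vertices of largest prescribed degree into one with
  all these degrees at least \<open>\<Delta>\<close>, and then into a realization of the sequence. So divisibility of
  \<open>\<sigma>\<close> by \<open>t\<close> suffices as soon as \<open>\<sigma> / t \<le> k choose t\<close>, and the condition on the exponents is exactly
  what makes this hold for all sufficiently long inputs. Apart from finitely many inputs, the problem
  is therefore to test \<open>t dvd \<sigma>\<close>, which a finite automaton can do.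
\<close>

section \<open>Moving hyperedges\<close>

lemma uniform_hypergraph_finite:
  assumes "finite V" "uniform_hypergraph t V E"
  shows "finite E"
  by (rule finite_subset[of _ "Pow V"]) (use assms in \<open>auto simp: uniform_hypergraph_def\<close>)

lemma handshake:
  assumes "finite V" "uniform_hypergraph t V E"
  shows "(\<Sum>v\<in>V. hdegree E v) = t * card E"
proof -
  have fin: "finite E" using assms by (rule uniform_hypergraph_finite)
  have "(\<Sum>v\<in>V. hdegree E v) = (\<Sum>v\<in>V. \<Sum>e\<in>E. if v \<in> e then 1 else 0)"
    using fin by (simp add: hdegree_def flip: sum.inter_filter)
  also have "\<dots> = (\<Sum>e\<in>E. \<Sum>v\<in>V. if v \<in> e then 1 else 0)"
    by (rule sum.swap)
  also have "\<dots> = (\<Sum>e\<in>E. t)"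
  proof (rule sum.cong)
    fix e assume "e \<in> E"
    then have "e \<subseteq> V" "card e = t" using assms by (auto simp: uniform_hypergraph_def)
    moreover have "{v \<in> V. v \<in> e} = e" using \<open>e \<subseteq> V\<close> by auto
    ultimately show "(\<Sum>v\<in>V. if v \<in> e then 1 else 0) = t"
      using assms(1) by (simp flip: sum.inter_filter)
  qed simp
  finally show ?thesis by simp
qed

text \<open>Both corrections are added because subtraction on \<open>nat\<close> would truncate; one
  equation then covers all four membership cases.\<close>

lemma hdegree_replace:
  assumes "finite E" "e \<in> E" "e' \<notin> E"
  shows "hdegree (insert e' (E - {e})) v + of_bool (v \<in> e) = hdegree E v + of_bool (v \<in> e')"
proof -
  let ?R = "{x \<in> E - {e}. v \<in> x}"
  have fin: "finite ?R" using assms by simp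
  have 1: "{x \<in> E. v \<in> x} = (if v \<in> e then insert e ?R else ?R)"
    and 2: "{x \<in> insert e' (E - {e}). v \<in> x} = (if v \<in> e' then insert e' ?R else ?R)"
    using assms by auto
  show ?thesis unfolding hdegree_def 1 2 using fin assms by auto
qed

text \<open>More hyperedges contain \<open>v\<close> but not \<open>w\<close> than \<open>w\<close>
  but not \<open>v\<close>. Exchanging \<open>v\<close> for \<open>w\<close> is injective on the
  former, so by pigeonhole some image is not yet a hyperedge and may replace its original.\<close>

lemma shift_hyperedge:
  assumes "finite V" "uniform_hypergraph t V E" "v \<in> V" "w \<in> V" "hdegree E w < hdegree E v"
  obtains E' where "uniform_hypergraph t V E'" "card E' = card E"
    "\<And>u. hdegree E' u + of_bool (u = v) = hdegree E u + of_bool (u = w)"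
proof -
  have fin: "finite E" using assms(1,2) by (rule uniform_hypergraph_finite)
  define P where "P = {e \<in> E. v \<in> e \<and> w \<notin> e}"
  define Q where "Q = {e \<in> E. w \<in> e \<and> v \<notin> e}"
  define B where "B = {e \<in> E. v \<in> e \<and> w \<in> e}"
  have "{e \<in> E. v \<in> e} = P \<union> B" "{e \<in> E. w \<in> e} = Q \<union> B"
    by (auto simp: P_def Q_def B_def)
  moreover have "finite P" "finite Q" "finite B" "P \<inter> B = {}" "Q \<inter> B = {}"
    using fin by (auto simp: P_def Q_def B_def)
  ultimately have "hdegree E v = card P + card B" "hdegree E w = card Q + card B"
    by (simp_all add: hdegree_def card_Un_disjoint)
  then have less: "card Q < card P" using assms by simp
  define f where "f e = insert w (e - {v})" for e
  have "inj_on f P"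
  proof (rule inj_onI)
    fix x y assume "x \<in> P" "y \<in> P" "f x = f y"
    then have "insert v (f x - {w}) = x" "insert v (f y - {w}) = y"
      unfolding f_def P_def by blast+
    then show "x = y" using \<open>f x = f y\<close> by metis
  qed
  then have "\<not> f ` P \<subseteq> Q"
    using less fin card_inj_on_le[of f P Q] by (auto simp: Q_def)
  then obtain e where e: "e \<in> P" "f e \<notin> Q" by auto
  have vw: "v \<noteq> w" using assms by auto
  have eE: "e \<in> E" "v \<in> e" "w \<notin> e" using e by (auto simp: P_def)
  \<comment> \<open>The set \<open>f e\<close> contains \<open>w\<close> but not \<open>v\<close>,
    so within \<open>E\<close> it could only lie in \<open>Q\<close>.\<close>
  have feE: "f e \<notin> E" using e vw by (auto simp: Q_def f_def)
  have efin: "finite e" "card e = t" "e \<subseteq> V"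
    using assms eE by (auto simp: uniform_hypergraph_def dest: finite_subset)
  have "card (f e) = Suc (card (e - {v}))"
    unfolding f_def using eE efin by (intro card_insert_disjoint) auto
  also have "\<dots> = t" using eE efin by (metis card.remove)
  finally have "card (f e) = t" .
  then have "uniform_hypergraph t V (insert (f e) (E - {e}))"
    using assms efin by (auto simp: uniform_hypergraph_def f_def)
  moreover have "card (insert (f e) (E - {e})) = card E"
    using fin feE eE by (metis Diff_iff card.remove card_insert_disjoint finite_Diff)
  moreover have "hdegree (insert (f e) (E - {e})) u + of_bool (u = v) = hdegree E u + of_bool (u = w)"
    for u
    using hdegree_replace[OF fin eE(1) feE, of u] eE vw by (cases "u \<in> e") (auto simp: f_def split: if_splits)
  ultimately show thesis by (rule that)
qed

text \<open>Moves only shrink the sets of vertices of too large and of too small degree, so the last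
  hypothesis is preserved.\<close>

lemma hdegree_ge_by_shifting:
  assumes "finite V" "uniform_hypergraph t V E"
    and "(\<Sum>v\<in>V. d v) \<le> (\<Sum>v\<in>V. hdegree E v)"
    and "\<And>v w. \<lbrakk>v \<in> V; w \<in> V; d v < hdegree E v; hdegree E w < d w\<rbrakk> \<Longrightarrow> d w \<le> d v"
  obtains E' where "uniform_hypergraph t V E'" "card E' = card E" "\<forall>v\<in>V. d v \<le> hdegree E' v"
proof -
  have "\<exists>E'. uniform_hypergraph t V E' \<and> card E' = card E \<and> (\<forall>v\<in>V. d v \<le> hdegree E' v)"
    using assms(2-4)
  \<comment> \<open>The measure is the total deficit: by truncation, vertices above their target
    contribute 0.\<close>
  proof (induction "\<Sum>v\<in>V. d v - hdegree E v" arbitrary: E rule: less_induct)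
    case less
    show ?case
    proof (cases "\<forall>v\<in>V. d v \<le> hdegree E v")
      case True
      then show ?thesis using less.prems by blast
    next
      case False
      then obtain w where w: "w \<in> V" "hdegree E w < d w" by (auto simp: not_le)
      have "\<exists>v\<in>V. d v < hdegree E v"
      proof (rule ccontr)
        assume "\<not> ?thesis"
        then have "(\<Sum>v\<in>V. hdegree E v) < (\<Sum>v\<in>V. d v)"
          using w assms(1) by (intro sum_strict_mono_ex1) (auto simp: not_less)
        then show False using less.prems by simp
      qed
      then obtain v where v: "v \<in> V" "d v < hdegree E v" by auto
      \<comment> \<open>This links \<open>hdegree E w < d w\<close> and
        \<open>d v < hdegree E v\<close> into a chain, which permits a move from \<open>v\<close> to
        \<open>w\<close>.\<close>
      have "d w \<le> d v" using less.prems(3) v w by blast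
      then have vw: "hdegree E w < hdegree E v" "v \<noteq> w" using v w by auto
      obtain E' where E': "uniform_hypergraph t V E'" "card E' = card E"
        and deg: "\<And>u. hdegree E' u + of_bool (u = v) = hdegree E u + of_bool (u = w)"
        by (rule shift_hyperedge[OF assms(1) less.prems(1) v(1) w(1) vw(1)]) (rule that)
      have deg_v: "Suc (hdegree E' v) = hdegree E v" and deg_w: "hdegree E' w = Suc (hdegree E w)"
        using deg[of v] deg[of w] vw by simp_all
      have deg_u: "hdegree E' u = hdegree E u" if "u \<noteq> v" "u \<noteq> w" for u
        using deg[of u] that by simp
      \<comment> \<open>The degree of \<open>v\<close> starts above its target and drops by one,
        that of \<open>w\<close> starts below and rises by one, so neither crosses its
        target.\<close>
      have over: "d u < hdegree E u" if "d u < hdegree E' u" for u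
        using that deg_v deg_w deg_u[of u] w by (cases "u = v"; cases "u = w") auto
      have under: "hdegree E u < d u" if "hdegree E' u < d u" for u
        using that deg_v deg_w deg_u[of u] v by (cases "u = v"; cases "u = w") auto
      have "\<exists>E''. uniform_hypergraph t V E'' \<and> card E'' = card E' \<and> (\<forall>v\<in>V. d v \<le> hdegree E'' v)"
      proof (rule less.hyps)
        show "(\<Sum>u\<in>V. d u - hdegree E' u) < (\<Sum>u\<in>V. d u - hdegree E u)"
        proof (rule sum_strict_mono_ex1)
          show "\<forall>u\<in>V. d u - hdegree E' u \<le> d u - hdegree E u"
          proof
            fix u
            show "d u - hdegree E' u \<le> d u - hdegree E u"
              using deg_v deg_w deg_u[of u] v by (cases "u = v"; cases "u = w") auto
          qed
          show "\<exists>u\<in>V. d u - hdegree E' u < d u - hdegree E u"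
            using w deg_w by (intro bexI[of _ w]) auto
        qed (fact assms(1))
        show "(\<Sum>v\<in>V. d v) \<le> (\<Sum>v\<in>V. hdegree E' v)"
          using less.prems(2) E' handshake[OF assms(1) E'(1)] handshake[OF assms(1) less.prems(1)]
          by simp
        show "d w \<le> d v" if "v \<in> V" "w \<in> V" "d v < hdegree E' v" "hdegree E' w < d w" for v w
          using less.prems(3)[OF that(1,2)] over[OF that(3)] under[OF that(4)] by simp
      qed (fact E'(1))
      then show ?thesis using E'(2) by auto
    qed
  qed
  then show thesis using that by blast
qed

section \<open>Realizing sequences with small maximal degree\<close>

lemma ex_largest_subset:
  fixes d :: "'v \<Rightarrow> nat"
  assumes "finite V" "k \<le> card V"
  shows "\<exists>A\<subseteq>V. card A = k \<and> (\<forall>v\<in>A. \<forall>w\<in>V - A. d w \<le> d v)"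
  using assms(2)
proof (induction k)
  case 0
  then show ?case by (intro exI[of _ "{}"]) auto
next
  case (Suc k)
  then obtain A where A: "A \<subseteq> V" "card A = k" "\<forall>v\<in>A. \<forall>w\<in>V - A. d w \<le> d v"
    by auto
  have finA: "finite A" using A assms finite_subset by blast
  have "V - A \<noteq> {}" using A Suc.prems by auto
  then obtain x where x: "x \<in> V - A" "d x = Max (d ` (V - A))"
    using Max_in[of "d ` (V - A)"] assms by fastforce
  then have "\<forall>w\<in>V - A. d w \<le> d x" using assms by simp
  then show ?case using A x finA by (intro exI[of _ "insert x A"]) auto
qed

lemma hypergraphic_of_small_max:
  fixes d :: "'v \<Rightarrow> nat"
  assumes "finite V" and "\<And>v. v \<in> V \<Longrightarrow> d v \<le> \<Delta>" and "\<Delta> > 0" and "t > 0"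
    and "(\<Sum>v\<in>V. d v) = t * m" and "m \<le> ((\<Sum>v\<in>V. d v) div \<Delta>) choose t"
  obtains E where "uniform_hypergraph t V E" "\<forall>v\<in>V. hdegree E v = d v"
proof -
  define k where "k = (\<Sum>v\<in>V. d v) div \<Delta>"
  have "(\<Sum>v\<in>V. d v) \<le> (\<Sum>v\<in>V. \<Delta>)" using assms(2) by (rule sum_mono)
  then have "(\<Sum>v\<in>V. d v) \<le> card V * \<Delta>" by simp
  then have "k \<le> card V"
    unfolding k_def using \<open>\<Delta> > 0\<close>
    by (metis div_le_mono nonzero_mult_div_cancel_right not_gr0)
  then obtain A where A: "A \<subseteq> V" "card A = k" "\<forall>v\<in>A. \<forall>w\<in>V - A. d w \<le> d v"
    using ex_largest_subset assms(1) by metis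
  have finA: "finite A" using A assms(1) finite_subset by blast
  have "m \<le> card {e. e \<subseteq> A \<and> card e = t}"
    using assms(6) A finA by (simp add: n_subsets k_def)
  then obtain E0 where E0: "E0 \<subseteq> {e. e \<subseteq> A \<and> card e = t}" "card E0 = m"
    by (meson obtain_subset_with_card_n)
  then have u0: "uniform_hypergraph t A E0" by (auto simp: uniform_hypergraph_def)
  \<comment> \<open>By the choice of \<open>k\<close>, \<open>k * \<Delta>\<close> is at most the
    degree sum \<open>t * m\<close>. For the constant target \<open>\<Delta>\<close> the ordering
    hypothesis on moves is trivial.\<close>
  have "(\<Sum>v\<in>A. \<Delta>) \<le> (\<Sum>v\<in>A. hdegree E0 v)"
    using handshake[OF finA u0] E0(2) A(2) assms(5) by (simp add: k_def)
  then obtain E1 where u1: "uniform_hypergraph t A E1" and c1: "card E1 = m"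
    and d1: "\<forall>v\<in>A. \<Delta> \<le> hdegree E1 v"
    using hdegree_ge_by_shifting[OF finA u0, of "\<lambda>_. \<Delta>"] E0(2) by auto
  have u1': "uniform_hypergraph t V E1"
    using u1 A(1) by (auto simp: uniform_hypergraph_def)
  have out: "hdegree E1 w = 0" if "w \<notin> A" for w
  proof -
    have "{e \<in> E1. w \<in> e} = {}" using u1 that by (auto simp: uniform_hypergraph_def)
    then show ?thesis by (simp only: hdegree_def card.empty)
  qed
  have ge: "d v \<le> hdegree E1 v" if "v \<in> A" for v
    using that d1 A(1) assms(2)[of v] by fastforce
  \<comment> \<open>Degrees vanish outside \<open>A\<close> and meet their targets inside, so excess
    occurs only inside \<open>A\<close> and deficit only outside. The choice of \<open>A\<close>
    then gives the ordering.\<close>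
  have ord: "d w \<le> d v" if "v \<in> V" "w \<in> V" "d v < hdegree E1 v" "hdegree E1 w < d w" for v w
  proof -
    have "v \<in> A" using out[of v] that by auto
    moreover have "w \<notin> A" using ge[of w] that by auto
    ultimately show ?thesis using A(3) that by auto
  qed
  have "(\<Sum>v\<in>V. d v) \<le> (\<Sum>v\<in>V. hdegree E1 v)"
    using handshake[OF assms(1) u1'] c1 assms(5) by simp
  from hdegree_ge_by_shifting[OF assms(1) u1' this ord]
  obtain E where E: "uniform_hypergraph t V E" "card E = card E1" "\<forall>v\<in>V. d v \<le> hdegree E v"
    by auto
  \<comment> \<open>Equal sums turn the pointwise inequalities into equalities.\<close>
  have "(\<Sum>v\<in>V. hdegree E v) = (\<Sum>v\<in>V. d v)"
    using handshake[OF assms(1) E(1)] E(2) c1 assms(5) by simp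
  then have "\<forall>v\<in>V. hdegree E v = d v"
    using sum_mono_inv[of d V "hdegree E"] E(3) assms(1) by fastforce
  then show thesis using that E(1) by blast
qed

lemma dvd_sum_list_of_uni_hypergraphic:
  assumes "uni_hypergraphic t D"
  shows "t dvd sum_list D"
proof -
  obtain E where E: "uniform_hypergraph t {..<length D} E" "\<forall>i<length D. hdegree E i = D ! i"
    using assms by (auto simp: uni_hypergraphic_def)
  have "sum_list D = (\<Sum>i<length D. hdegree E i)"
    using E(2) by (simp add: sum_list_sum_nth atLeast0LessThan)
  then show ?thesis using handshake[OF _ E(1)] by simp
qed

text \<open>With \<open>k = sum_list D div \<Delta>\<close>, the degree sum is at most
  \<open>2 * k * \<Delta>\<close>. The absorption identity
  \<open>k * ((k - 1) choose (t - 1)) = t * (k choose t)\<close> then yields the required bound on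
  the number of hyperedges.\<close>

lemma uni_hypergraphic_of_binomial_ge:
  assumes "\<And>d. d \<in> set D \<Longrightarrow> d \<le> \<Delta>" and "\<Delta> > 0" and "t > 0" and "t dvd sum_list D"
    and "\<Delta> \<le> sum_list D" and "2 * \<Delta> \<le> (sum_list D div \<Delta> - 1) choose (t - 1)"
  shows "uni_hypergraphic t D"
proof -
  define k where "k = sum_list D div \<Delta>"
  have k: "k \<ge> 1" using assms(2,5) by (simp add: k_def Suc_le_eq div_greater_zero_iff)
  obtain m where m: "sum_list D = t * m" using assms(4) by (auto simp: dvd_def)
  have sum: "sum_list D = (\<Sum>i<length D. D ! i)"
    by (simp add: sum_list_sum_nth atLeast0LessThan)
  \<comment> \<open>The remainder is below \<open>\<Delta>\<close> and \<open>k\<close> is positive;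
    this costs the factor 2.\<close>
  have "sum_list D mod \<Delta> \<le> k * \<Delta>"
    using mod_less_divisor[OF assms(2), of "sum_list D"] k by (cases k) auto
  then have "t * m \<le> k * \<Delta> + k * \<Delta>"
    using div_mult_mod_eq[of "sum_list D" \<Delta>] m unfolding k_def by linarith
  also have "\<dots> = k * (2 * \<Delta>)" by simp
  also have "\<dots> \<le> k * ((k - 1) choose (t - 1))"
    using assms(6) by (intro mult_left_mono) (auto simp: k_def)
  also have "\<dots> = t * (k choose t)"
    using times_binomial_minus1_eq[OF assms(3), of k] by simp
  finally have "m \<le> k choose t" using assms(3) by simp
  then show ?thesis
    unfolding uni_hypergraphic_def
    using hypergraphic_of_small_max[of "{..<length D}" "\<lambda>i. D ! i" \<Delta> t m] assms m sum
    by (metis finite_lessThan k_def lessThan_iff nth_mem)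
qed

section \<open>Long sparse sequences\<close>

text \<open>The degree sum is at least \<open>n powr (1 + \<alpha>')\<close> and the maximum at most
  \<open>6 * n powr \<alpha>\<close>, so \<open>k\<close> grows at least like
  \<open>n powr \<gamma>\<close> with \<open>\<gamma> = 1 + \<alpha>' - \<alpha>\<close>. The
  binomial coefficient thus grows at least like \<open>n powr (\<gamma> * (t - 1))\<close> and
  outgrows twice the maximum once \<open>\<gamma> * (t - 1) > \<alpha>\<close>.\<close>

lemma eventually_sparse_uni_hypergraphic_iff:
  fixes t :: nat and \<alpha>' \<alpha> :: real
  assumes "t \<ge> 2" and "0 \<le> \<alpha>" and "\<alpha>' > (real t * (\<alpha> - 1) + 1) / (real t - 1)"
  shows "\<forall>\<^sub>F n in sequentially. \<forall>D\<in>sparse_HDS_inputs \<alpha>' \<alpha>. length D = n \<longrightarrow>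
    (uni_hypergraphic t D \<longleftrightarrow> t dvd sum_list D)"
proof -
  define s where "s = t - 1"
  have s: "s \<ge> 1" "real t = real s + 1" using assms(1) by (auto simp: s_def)
  define \<gamma> where "\<gamma> = 1 + \<alpha>' - \<alpha>"
  \<comment> \<open>This is the hypothesis on the exponents, multiplied by \<open>t - 1\<close> and
    rearranged.\<close>
  have \<gamma>s: "\<gamma> * s > \<alpha>"
    using assms(3) s by (simp add: \<gamma>_def field_simps)
  then have "0 < \<gamma> * s" using assms(2) by linarith
  then have \<gamma>: "\<gamma> > 0" using s by (simp add: zero_less_mult_iff)
  have lim: "filterlim (\<lambda>n::nat. real n powr c) at_top sequentially" if "c > 0" for c :: real
  proof -
    have "filterlim (\<lambda>n::nat. exp (c * ln (real n))) at_top sequentially"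
      by (intro filterlim_compose[OF exp_at_top] filterlim_compose[OF ln_at_top]
          filterlim_tendsto_pos_mult_at_top[OF tendsto_const that] filterlim_real_sequentially)
    moreover have "\<forall>\<^sub>F n::nat in sequentially. exp (c * ln (real n)) = real n powr c"
      using eventually_gt_at_top[of 0] by eventually_elim (simp add: powr_def)
    ultimately show ?thesis by (rule filterlim_cong[OF refl refl, THEN iffD1, rotated])
  qed
  \<comment> \<open>From 24 on, \<open>x / 6 - 2\<close> is at least \<open>x / 12\<close>, which
    turns a bound on \<open>k + 1\<close> into one on \<open>k - 1\<close>. In the next bound, the
    leading 12 is twice the 6 of the input condition, and \<open>(12 * s) ^ s\<close> clears the
    denominator of the binomial estimate.\<close>
  have "\<forall>\<^sub>F n::nat in sequentially. 24 \<le> real n powr \<gamma>"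
    using lim[OF \<gamma>] by (simp add: filterlim_at_top)
  moreover have "\<forall>\<^sub>F n::nat in sequentially. 12 * (12 * s) ^ s \<le> real n powr (\<gamma> * s - \<alpha>)"
    using lim[of "\<gamma> * s - \<alpha>"] \<gamma>s by (simp add: filterlim_at_top)
  ultimately show ?thesis using eventually_gt_at_top[of 0]
  proof eventually_elim
    case (elim n)
    show ?case
    proof (intro ballI impI iffI dvd_sum_list_of_uni_hypergraphic)
      fix D assume D: "D \<in> sparse_HDS_inputs \<alpha>' \<alpha>" "length D = n" "t dvd sum_list D"
      have n: "real n > 0" using elim by simp
      have lower: "real n powr \<alpha>' \<le> d" and upper: "d \<le> 6 * real n powr \<alpha>" if "d \<in> set D" for d
        using D that by (auto simp: sparse_HDS_inputs_def)
      have ne: "D \<noteq> []" using elim D by auto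
      define \<Delta> where "\<Delta> = Max (set D)"
      have \<Delta>D: "\<Delta> \<in> set D" unfolding \<Delta>_def using ne by (intro Max_in) auto
      have le\<Delta>: "d \<le> \<Delta>" if "d \<in> set D" for d using that by (simp add: \<Delta>_def)
      have "0 < real n powr \<alpha>'" using n by simp
      then have "0 < real \<Delta>" using lower[OF \<Delta>D] by linarith
      then have \<Delta>pos: "\<Delta> > 0" by simp
      have "real n powr (1 + \<alpha>') = real n * real n powr \<alpha>'" using n by (simp add: powr_add)
      also have "\<dots> = (\<Sum>d\<leftarrow>D. real n powr \<alpha>')" using D(2) by (simp add: sum_list_triv)
      also have "\<dots> \<le> (\<Sum>d\<leftarrow>D. real d)" by (intro sum_list_mono lower)
      also have "\<dots> = real (sum_list D)" by (induction D) auto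
      finally have sum: "real n powr (1 + \<alpha>') \<le> sum_list D" .
      define k where "k = sum_list D div \<Delta>"
      have "real n powr \<gamma> * real n powr \<alpha> = real n powr (1 + \<alpha>')"
        by (simp add: \<gamma>_def flip: powr_add)
      also have "\<dots> \<le> real (sum_list D)" by (fact sum)
      also have "\<dots> = real (k * \<Delta> + sum_list D mod \<Delta>)" unfolding k_def by simp
      also have "\<dots> \<le> real (k * \<Delta> + \<Delta>)"
        using mod_less_divisor[OF \<Delta>pos, of "sum_list D"] by (intro of_nat_mono) simp
      also have "\<dots> = (real k + 1) * real \<Delta>" by (simp add: algebra_simps)
      also have "\<dots> \<le> (real k + 1) * (6 * real n powr \<alpha>)"
        by (intro mult_left_mono upper \<Delta>D) auto
      finally have "real n powr \<gamma> \<le> 6 * (real k + 1)" using n by simp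
      then have k: "real n powr \<gamma> / 12 \<le> real k - 1" using elim(1) by simp
      then have k3: "k \<ge> 3" using elim(1) by linarith
      show "uni_hypergraphic t D"
      proof (rule uni_hypergraphic_of_binomial_ge[OF le\<Delta> \<Delta>pos])
        show "\<Delta> \<le> sum_list D" using \<Delta>D by (rule member_le_sum_list) simp
        have "real n powr \<gamma> / (12 * s) \<le> real (k - 1) / s"
          using k k3 s by (simp add: divide_simps of_nat_diff)
        then have pw: "(real n powr \<gamma> / (12 * s)) ^ s \<le> (real (k - 1) / s) ^ s"
          by (intro power_mono) auto
        have "12 * real n powr \<alpha> * (12 * s) ^ s \<le> real n powr (\<gamma> * s - \<alpha>) * real n powr \<alpha>"
          using mult_right_mono[OF elim(2), of "real n powr \<alpha>"] by (simp add: mult_ac)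
        also have "\<dots> = real n powr (\<gamma> * s)" by (simp flip: powr_add)
        also have "\<dots> = (real n powr \<gamma>) ^ s" using n by (subst powr_powr[symmetric], subst powr_realpow) auto
        finally have "12 * real n powr \<alpha> \<le> (real n powr \<gamma> / (12 * s)) ^ s"
          using s by (simp add: power_divide pos_le_divide_eq)
        then have big: "2 * real \<Delta> \<le> (real (k - 1) / s) ^ s"
          using pw upper[OF \<Delta>D] by linarith
        \<comment> \<open>The binomial estimate requires this; otherwise the power would be at most
          1, hence below \<open>2 * \<Delta>\<close>.\<close>
        have "s \<le> k - 1"
        proof (rule ccontr)
          assume "\<not> s \<le> k - 1"
          then have "(real (k - 1) / s) ^ s \<le> 1" using s by (intro power_le_one) auto
          then show False using big \<Delta>pos by linarith
        qed
        then have "(real (k - 1) / s) ^ s \<le> real ((k - 1) choose s)"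
          by (rule binomial_ge_n_over_k_pow_k)
        then have "real (2 * \<Delta>) \<le> real ((k - 1) choose s)" using big by simp
        then show "2 * \<Delta> \<le> (sum_list D div \<Delta> - 1) choose (t - 1)"
          unfolding k_def s_def of_nat_le_iff .
      qed (use assms D in auto)
    qed
  qed
qed

text \<open>As \<alpha> is nonnegative, the upper bound on the entries grows with the length, so
  bounding the length bounds the entries too.\<close>

lemma finite_short_sparse_inputs:
  assumes "0 \<le> \<alpha>"
  shows "finite {D \<in> sparse_HDS_inputs \<alpha>' \<alpha>. length D < N}"
proof (rule finite_subset)
  define B where "B = nat \<lceil>6 * real N powr \<alpha>\<rceil>"
  show "{D \<in> sparse_HDS_inputs \<alpha>' \<alpha>. length D < N} \<subseteq> {D. set D \<subseteq> {..B} \<and> length D \<le> N}"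
  proof clarsimp
    fix D d assume D: "D \<in> sparse_HDS_inputs \<alpha>' \<alpha>" "length D < N" "d \<in> set D"
    then have "real d \<le> 6 * real (length D) powr \<alpha>" by (auto simp: sparse_HDS_inputs_def)
    also have "\<dots> \<le> 6 * real N powr \<alpha>" using D assms by (intro mult_left_mono powr_mono2) auto
    finally show "d \<le> B" unfolding B_def by linarith
  qed
  show "finite {D. set D \<subseteq> {..B} \<and> length D \<le> N}" by (rule finite_lists_length_le) simp
qed

section \<open>Finite automata as Turing machines\<close>

text \<open>Automaton state \<open>q\<close> becomes \<open>f q + 2\<close>, leaving 0 and 1 for the
  verdicts. The head only scans to the right; the first blank marks the end of the input and
  triggers the verdict.\<close>

definition dfa_tm :: "('q \<Rightarrow> nat) \<Rightarrow> 'q set \<Rightarrow> 'q \<Rightarrow> ('q \<Rightarrow> sym \<Rightarrow> 'q) \<Rightarrow> ('q \<Rightarrow> bool) \<Rightarrow> tm" where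
  "dfa_tm f Q q0 \<delta> F =
     \<lparr> num_tapes = 1, states = {0, 1} \<union> (\<lambda>q. f q + 2) ` Q, symbols = {Blank, Zero, One, Sep},
       start = f q0 + 2, accept = 0, reject = 1,
       delta = (\<lambda>p xs.
         if p < 2 then (p, [(Blank, Stay)])
         else let q = the_inv_into Q f (p - 2); c = hd xs in
           if c = Blank then (if F q then 0 else 1, [(Blank, Stay)])
           else (f (\<delta> q c) + 2, [(c, GoRight)])) \<rparr>"

lemma wf_dfa_tm:
  assumes "finite Q" "inj_on f Q" "q0 \<in> Q" and "\<And>q c. q \<in> Q \<Longrightarrow> \<delta> q c \<in> Q"
  shows "wf_tm (dfa_tm f Q q0 \<delta> F)"
  using assms
  by (auto simp: wf_tm_def dfa_tm_def Let_def the_inv_into_f_f length_Suc_conv)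

text \<open>Each symbol is written back, so the tape stays fixed, and no blank inside the word
  triggers an early verdict. Closure of \<open>Q\<close> keeps \<open>f\<close> invertible on the
  states reached.\<close>

lemma dfa_tm_run:
  assumes "inj_on f Q" "q0 \<in> Q" and closed: "\<And>q c. q \<in> Q \<Longrightarrow> \<delta> q c \<in> Q"
    and "Blank \<notin> set w" and "k \<le> length w"
  shows "(step (dfa_tm f Q q0 \<delta> F) ^^ k) (init_config (dfa_tm f Q q0 \<delta> F) w) =
    (f (foldl \<delta> q0 (take k w)) + 2, [(fst (input_tape w), int k)])"
  using assms(5)
proof (induction k)
  case 0
  then show ?case by (simp add: init_config_def dfa_tm_def input_tape_def)
next
  case (Suc k)
  have "foldl \<delta> q u \<in> Q" if "q \<in> Q" for q u
    using that closed by (induction u arbitrary: q) auto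
  then have inQ: "foldl \<delta> q0 (take k w) \<in> Q" using assms(2) by blast
  have k: "k < length w" using Suc.prems by simp
  then have "w ! k \<noteq> Blank" using assms(4) nth_mem by metis
  then show ?case
    using Suc.IH k inQ assms(1)
    by (simp add: dfa_tm_def input_tape_def read_tape_def the_inv_into_f_f take_Suc_conv_app_nth
        Let_def fun_eq_iff)
qed

lemma solvable_in_linear_time_dfa:
  assumes "finite Q" "q0 \<in> Q" and closed: "\<And>q c. q \<in> Q \<Longrightarrow> \<delta> q c \<in> Q"
    and "\<And>x. x \<in> I \<Longrightarrow> Blank \<notin> set (enc x)"
    and "\<And>x. x \<in> I \<Longrightarrow> P x \<longleftrightarrow> F (foldl \<delta> q0 (enc x))"
  shows "solvable_in_linear_time enc I P"
proof -
  obtain f :: "_ \<Rightarrow> nat" where f: "inj_on f Q"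
    using finite_imp_inj_to_nat_seg[OF assms(1)] by blast
  let ?M = "dfa_tm f Q q0 \<delta> F"
  have wf: "wf_tm ?M" using assms(1) f assms(2) closed by (rule wf_dfa_tm)
  \<comment> \<open>One step per symbol, and a last one that reads the blank behind the
    word.\<close>
  have "state_after ?M (Suc (length (enc x))) (enc x) = (if P x then accept ?M else reject ?M)"
    if x: "x \<in> I" for x
  proof -
    have "foldl \<delta> q u \<in> Q" if "q \<in> Q" for q u
      using that closed by (induction u arbitrary: q) auto
    then have "foldl \<delta> q0 (enc x) \<in> Q" using assms(2) by blast
    then show ?thesis
      using dfa_tm_run[OF f assms(2) closed assms(4)[OF x] order_refl, where F = F] assms(5)[OF x] f
      by (simp add: state_after_def dfa_tm_def input_tape_def read_tape_def the_inv_into_f_f)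
  qed
  moreover have "(\<lambda>n. real (Suc n)) \<in> O(\<lambda>n. real n)"
    by (rule bigoI[of _ 2]) (auto intro!: eventually_mono[OF eventually_ge_at_top[of 1]])
  ultimately show ?thesis
    unfolding solvable_in_linear_time_def
    using wf by blast
qed

text \<open>The automaton additionally remembers the first \<open>L + 1\<close> symbols, which determine every word of
  length at most \<open>L\<close>.\<close>

lemma solvable_in_linear_time_dfa_almost_all:
  assumes "finite Q" "q0 \<in> Q" and closed: "\<And>q c. q \<in> Q \<Longrightarrow> \<delta> q c \<in> Q"
    and "inj_on enc I" and alpha: "\<And>x. x \<in> I \<Longrightarrow> set (enc x) \<subseteq> {Zero, One, Sep}"
    and exc: "finite {x \<in> I. P x \<noteq> F (foldl \<delta> q0 (enc x))}"
  shows "solvable_in_linear_time enc I P"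
proof -
  define X where "X = {x \<in> I. P x \<noteq> F (foldl \<delta> q0 (enc x))}"
  \<comment> \<open>The inserted 0 keeps \<open>Max\<close> meaningful when there are no
    exceptions.\<close>
  define L where "L = Max (insert 0 ((length \<circ> enc) ` X))"
  have L: "length (enc x) \<le> L" if "x \<in> X" for x
    unfolding L_def using that exc by (intro Max_ge) (auto simp: X_def)
  define S where "S = enc ` {x \<in> I. P x}"
  define W where "W = {u. set u \<subseteq> {Zero, One, Sep} \<and> length u \<le> Suc L}"
  \<comment> \<open>Symbols outside the input alphabet are not recorded, so \<open>W\<close> is
    closed under every symbol.\<close>
  define \<delta>' where "\<delta>' = (\<lambda>(u, q) c. (if c \<in> {Zero, One, Sep} then take (Suc L) (u @ [c]) else u, \<delta> q c))"
  \<comment> \<open>A remembered word of length at most \<open>L\<close> is the whole input and is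
    looked up in \<open>S\<close>. Length \<open>L + 1\<close> signals a longer input, on which the
    given automaton is right by the choice of \<open>L\<close>.\<close>
  define F' where "F' = (\<lambda>(u, q). if length u \<le> L then u \<in> S else F q)"
  have fold: "foldl \<delta>' ([], q0) w = (take (Suc L) w, foldl \<delta> q0 w)"
    if "set w \<subseteq> {Zero, One, Sep}" for w
    using that
  proof (induction w rule: rev_induct)
    case (snoc c w)
    then show ?case by (auto simp: \<delta>'_def min_def)
  qed simp
  show ?thesis
  proof (rule solvable_in_linear_time_dfa[where Q = "W \<times> Q" and \<delta> = \<delta>' and F = F'])
    show "finite (W \<times> Q)"
      using assms(1) unfolding W_def by (intro finite_cartesian_product finite_lists_length_le) auto
    show "([], q0) \<in> W \<times> Q" using assms(2) by (simp add: W_def)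
    show "\<delta>' q c \<in> W \<times> Q" if "q \<in> W \<times> Q" for q c
      using that closed by (auto simp: \<delta>'_def W_def dest!: in_set_takeD split: if_splits)
    show "Blank \<notin> set (enc x)" if "x \<in> I" for x using alpha[OF that] by auto
    show "P x \<longleftrightarrow> F' (foldl \<delta>' ([], q0) (enc x))" if x: "x \<in> I" for x
    proof (cases "length (enc x) \<le> L")
      case True
      have "enc x \<in> S \<longleftrightarrow> P x"
        using x assms(4) by (auto simp: S_def dest: inj_onD)
      then show ?thesis using True fold[OF alpha[OF x]] by (simp add: F'_def)
    next
      case False
      then have "x \<notin> X" using L by blast
      then show ?thesis using False x fold[OF alpha[OF x]] by (simp add: F'_def X_def)
    qed
  qed
qed

section \<open>Divisibility of the sum\<close>

text \<open>State \<open>(a, b)\<close>: the residues of the sum of the completed entries and of the value of the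
  digits read since the last separator.\<close>

fun residue_step :: "nat \<Rightarrow> nat \<times> nat \<Rightarrow> sym \<Rightarrow> nat \<times> nat" where
  "residue_step t (a, b) Zero = (a, (2 * b) mod t)"
| "residue_step t (a, b) One = (a, (2 * b + 1) mod t)"
| "residue_step t (a, b) Sep = ((a + b) mod t, 0)"
| "residue_step t (a, b) _ = (a, b)"

text \<open>Reading digits from the most significant one is Horner's scheme modulo
  \<open>t\<close>.\<close>

lemma residue_step_bin: "foldl (residue_step t) (a, 0) (bin d) = (a, d mod t)"
proof (induction d rule: less_induct)
  case (less d)
  show ?case
  proof (cases "d = 0")
    case False
    then have IH: "foldl (residue_step t) (a, 0) (bin (d div 2)) = (a, d div 2 mod t)"
      using less by simp
    have "(2 * (d div 2 mod t) + d mod 2) mod t = (2 * (d div 2) + d mod 2) mod t"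
      by (metis mod_add_left_eq mod_mult_right_eq)
    then have "(2 * (d div 2 mod t) + d mod 2) mod t = d mod t" by (simp only: mult_div_mod_eq)
    then show ?thesis
      using False IH by (subst bin.simps) (auto simp: even_iff_mod_2_eq_zero odd_iff_mod_2_eq_one)
  qed (simp add: bin.simps)
qed

lemma residue_step_enc_seq:
  "foldl (residue_step t) (a mod t, 0) (enc_seq D) = ((a + sum_list D) mod t, 0)"
proof (induction D arbitrary: a)
  case (Cons d D)
  have "foldl (residue_step t) (a mod t, 0) (enc_seq (d # D)) =
    foldl (residue_step t) ((a + d) mod t, 0) (enc_seq D)"
    by (simp add: enc_seq_def residue_step_bin mod_simps)
  then show ?case using Cons by (simp add: add.assoc)
qed (simp add: enc_seq_def)

lemma set_bin: "set (bin n) \<subseteq> {Zero, One}"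
proof (induction n rule: less_induct)
  case (less n)
  then show ?case by (subst bin.simps) auto
qed

theorem theorem4:
  fixes t :: nat and \<alpha>' \<alpha> :: real
  assumes "t \<ge> 3"
    and "0 \<le> \<alpha>'" and "\<alpha>' \<le> \<alpha>" and "\<alpha> < real t - 1"
    and "\<alpha>' > (real t * (\<alpha> - 1) + 1) / (real t - 1)"
  shows "solvable_in_linear_time enc_seq (sparse_HDS_inputs \<alpha>' \<alpha>) (uni_hypergraphic t)"
proof (rule solvable_in_linear_time_dfa_almost_all
    [where Q = "{..<t} \<times> {..<t}" and \<delta> = "residue_step t" and ?q0.0 = "(0, 0)"
      and F = "\<lambda>q. fst q = 0"])
  have \<alpha>: "0 \<le> \<alpha>" using assms by simp
  have "\<forall>\<^sub>F n in sequentially. \<forall>D\<in>sparse_HDS_inputs \<alpha>' \<alpha>. length D = n \<longrightarrow>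
    (uni_hypergraphic t D \<longleftrightarrow> t dvd sum_list D)"
    using assms by (intro eventually_sparse_uni_hypergraphic_iff \<alpha>) auto
  then obtain N where N: "\<And>D. D \<in> sparse_HDS_inputs \<alpha>' \<alpha> \<Longrightarrow> length D \<ge> N \<Longrightarrow>
      uni_hypergraphic t D \<longleftrightarrow> t dvd sum_list D"
    by (auto simp: eventually_sequentially)
  have run: "foldl (residue_step t) (0, 0) (enc_seq D) = (sum_list D mod t, 0)" for D
    using residue_step_enc_seq[of t 0 D] by simp
  \<comment> \<open>Acceptance means \<open>t dvd sum_list D\<close>, so every exception has length
    below \<open>N\<close>.\<close>
  show "finite {D \<in> sparse_HDS_inputs \<alpha>' \<alpha>.
      uni_hypergraphic t D \<noteq> (fst (foldl (residue_step t) (0, 0) (enc_seq D)) = 0)}"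
    by (rule finite_subset[OF _ finite_short_sparse_inputs[OF \<alpha>, of \<alpha>' N]])
      (use N in \<open>auto simp: run mod_eq_0_iff_dvd not_le[symmetric]\<close>)
  show "residue_step t q c \<in> {..<t} \<times> {..<t}" if "q \<in> {..<t} \<times> {..<t}" for q c
    using that assms(1) by (cases q; cases c) auto
  show "inj_on enc_seq (sparse_HDS_inputs \<alpha>' \<alpha>)" using inj_enc_seq by (rule inj_on_subset) simp
  show "set (enc_seq D) \<subseteq> {Zero, One, Sep}" for D
    using set_bin by (auto simp: enc_seq_def)
qed (use assms in auto)

end
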